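(* There exists no surface in $\mathbb{S}^3(r)$ and $\mathbb{H}^3(r)$ making a constant parallel angle with a fixed direction.
   Context: $\mathbb{S}^3(r)$ and $\mathbb{H}^3(r)$, $r>0$, are the three-dimensional sphere and hyperbolic space of radius $r$, i.e. the space forms of constant sectional curvature $1/r^2$ and $-1/r^2$, respectively. A regular surface $\Sigma^2$ with unit normal $\nu$ in a three-dimensional Riemannian manifold $M^3$ makes a constant parallel angle with a fixed direction (is a surface of constant parallel angle) if there exists a unit vector field $V$ of $M^3$ along $\Sigma^2$ (not necessarily tangent to $\Sigma^2$), parallel transported along any curve in $\Sigma^2$ (i.e. $\nabla_XV=0$ for all $X$ tangent to $\Sigma^2$, with $\nabla$ the Levi-Civita connection of $M^3$), such that $V$ and $\nu$ make a constant angle.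
   Formalization: The constant angles 0 and π (V equal to plus or minus the unit normal) are excluded: totally geodesic surfaces have a parallel unit normal and attain them, so the claim as worded fails there; nonexistence is stated for every other constant angle. *)

theory Defs
  imports "HOL-Analysis.Analysis"
begin

text \<open>
  The space forms are realised by their standard models: the sphere of radius \<open>r\<close> in Euclidean
  4-space, and the upper sheet of the hyperboloid \<open>g x x = - r\<^sup>2\<close> in Minkowski 4-space.  Both are
  handled by the same definitions, with a submanifold \<open>M\<close> of a vector space \<open>'a\<close> carrying a symmetric
  bilinear form \<open>g\<close> whose restriction to every tangent space of \<open>M\<close> is positive definite.
\<close>

definition lorentz :: "real \<times> (real^3) \<Rightarrow> real \<times> (real^3) \<Rightarrow> real" where
  "lorentz x y = snd x \<bullet> snd y - fst x * fst y"

definition hyperbolic_space :: "real \<Rightarrow> (real \<times> (real^3)) set" where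
  "hyperbolic_space r = {x. lorentz x x = - r\<^sup>2 \<and> fst x > 0}"

text \<open>\<open>Ck_on\<close> and \<open>smooth_on\<close> are meant for open domains only: they use derivatives
  \<open>at x\<close>, not \<open>at x within S\<close>.\<close>

primrec Ck_on :: "nat \<Rightarrow> 'a::real_normed_vector set \<Rightarrow> ('a \<Rightarrow> 'b::real_normed_vector) \<Rightarrow> bool" where
  "Ck_on 0 S f \<longleftrightarrow> continuous_on S f"
| "Ck_on (Suc k) S f \<longleftrightarrow>
     (\<forall>x\<in>S. f differentiable (at x)) \<and> (\<forall>v. Ck_on k S (\<lambda>x. frechet_derivative f (at x) v))"

definition smooth_on :: "'a::real_normed_vector set \<Rightarrow> ('a \<Rightarrow> 'b::real_normed_vector) \<Rightarrow> bool" where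
  "smooth_on S f \<longleftrightarrow> (\<forall>k. Ck_on k S f)"

definition tangent_space :: "'a::euclidean_space set \<Rightarrow> 'a \<Rightarrow> 'a set" where
  "tangent_space M p = {v. \<exists>c e. e > 0 \<and> smooth_on {-e<..<e} c \<and> c ` {-e<..<e} \<subseteq> M \<and>
     c (0::real) = p \<and> (c has_vector_derivative v) (at 0)}"

definition tangential_part :: "('a::euclidean_space \<Rightarrow> 'a \<Rightarrow> real) \<Rightarrow> 'a set \<Rightarrow> 'a \<Rightarrow> 'a" where
  "tangential_part g T w = (THE u. u \<in> T \<and> (\<forall>z\<in>T. g (w - u) z = 0))"

text \<open>The Levi-Civita covariant derivative of a vector field \<open>W\<close> of \<open>M\<close> along a curve \<open>c\<close> in \<open>M\<close>:
  since \<open>g\<close> is constant on the ambient vector space, the Levi-Civita connection of the induced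
  metric is the tangential part of the ambient directional derivative.\<close>

definition covariant_derivative ::
  "('a::euclidean_space \<Rightarrow> 'a \<Rightarrow> real) \<Rightarrow> 'a set \<Rightarrow> (real \<Rightarrow> 'a) \<Rightarrow> (real \<Rightarrow> 'a) \<Rightarrow> real \<Rightarrow> 'a" where
  "covariant_derivative g M c W t =
     tangential_part g (tangent_space M (c t)) (vector_derivative W (at t))"

definition local_parametrization ::
  "'a::euclidean_space set \<Rightarrow> (real^2) set \<Rightarrow> 'a set \<Rightarrow> (real^2 \<Rightarrow> 'a) \<Rightarrow> bool" where
  "local_parametrization S U W X \<longleftrightarrow>
     open U \<and> open W \<and> smooth_on U X \<and>
     (\<exists>Y. homeomorphism U (S \<inter> W) X Y) \<and>
     (\<forall>u\<in>U. inj (frechet_derivative X (at u)))"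

definition regular_surface :: "'a::euclidean_space set \<Rightarrow> bool" where
  "regular_surface S \<longleftrightarrow>
     S \<noteq> {} \<and> (\<forall>p\<in>S. \<exists>U W X. p \<in> W \<and> local_parametrization S U W X)"

definition smooth_along :: "'a::euclidean_space set \<Rightarrow> ('a \<Rightarrow> 'b::real_normed_vector) \<Rightarrow> bool" where
  "smooth_along S F \<longleftrightarrow>
     (\<forall>U W X. local_parametrization S U W X \<longrightarrow> smooth_on U (\<lambda>u. F (X u)))"

definition unit_field_along ::
  "('a::euclidean_space \<Rightarrow> 'a \<Rightarrow> real) \<Rightarrow> 'a set \<Rightarrow> 'a set \<Rightarrow> ('a \<Rightarrow> 'a) \<Rightarrow> bool" where
  "unit_field_along g M S V \<longleftrightarrow>
     smooth_along S V \<and> (\<forall>p\<in>S. V p \<in> tangent_space M p \<and> g (V p) (V p) = 1)"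

definition unit_normal ::
  "('a::euclidean_space \<Rightarrow> 'a \<Rightarrow> real) \<Rightarrow> 'a set \<Rightarrow> 'a set \<Rightarrow> ('a \<Rightarrow> 'a) \<Rightarrow> bool" where
  "unit_normal g M S \<nu> \<longleftrightarrow>
     unit_field_along g M S \<nu> \<and> (\<forall>p\<in>S. \<forall>v\<in>tangent_space S p. g (\<nu> p) v = 0)"

definition parallel_along ::
  "('a::euclidean_space \<Rightarrow> 'a \<Rightarrow> real) \<Rightarrow> 'a set \<Rightarrow> 'a set \<Rightarrow> ('a \<Rightarrow> 'a) \<Rightarrow> bool" where
  "parallel_along g M S V \<longleftrightarrow>
     (\<forall>c a b. smooth_on {a<..<b} c \<and> c ` {a<..<b} \<subseteq> S \<longrightarrow>
        (\<forall>t\<in>{a<..<b}. covariant_derivative g M c (\<lambda>s. V (c s)) t = 0))"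

definition metric_angle :: "('a \<Rightarrow> 'a \<Rightarrow> real) \<Rightarrow> 'a \<Rightarrow> 'a \<Rightarrow> real" where
  "metric_angle g x y = arccos (g x y / (sqrt (g x x) * sqrt (g y y)))"

text \<open>The angles \<open>0\<close> and \<open>pi\<close> are allowed here.  They occur exactly when \<open>V = \<plusminus>\<nu>\<close>, and they are
  attained by every totally geodesic surface, whose unit normal is itself parallel; a non-existence
  claim has to exclude them.\<close>

definition constant_parallel_angle ::
  "('a::euclidean_space \<Rightarrow> 'a \<Rightarrow> real) \<Rightarrow> 'a set \<Rightarrow> 'a set \<Rightarrow> ('a \<Rightarrow> 'a) \<Rightarrow> ('a \<Rightarrow> 'a) \<Rightarrow> real \<Rightarrow> bool" where
  "constant_parallel_angle g M S \<nu> V \<theta> \<longleftrightarrow>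
     regular_surface S \<and> S \<subseteq> M \<and> unit_normal g M S \<nu> \<and>
     unit_field_along g M S V \<and> parallel_along g M S V \<and>
     (\<forall>p\<in>S. metric_angle g (V p) (\<nu> p) = \<theta>)"

end

(*
  Write M for the space form, g x x = k on M.  A parallel field V along a chart X of the surface
  satisfies dV = - (1/k) g(V, dX) X in the ambient space.  Comparing the mixed second derivatives of
  V gives g(V, X_1) X_2 = g(V, X_2) X_1, so V is orthogonal to the surface because X_1 and X_2 are
  independent.  Hence V = \<nu> or V = -\<nu>, and the angle is 0 or pi at every point.
*)
theory Submission
  imports Defs
begin

section \<open>Smooth maps\<close>

lemma Ck_on_cong:
  assumes "open S" "\<And>x. x \<in> S \<Longrightarrow> f x = g x" "Ck_on k S f"
  shows "Ck_on k S g"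
  using assms(2,3)
proof (induction k arbitrary: f g)
  case 0
  then show ?case using continuous_on_cong by force
next
  case (Suc k)
  have D: "(g has_derivative frechet_derivative f (at x)) (at x)" if "x \<in> S" for x
    using Suc.prems that \<open>open S\<close> has_derivative_transform_within_open[of f _ x UNIV S g]
    by (auto simp: frechet_derivative_works)
  have "Ck_on k S (\<lambda>x. frechet_derivative g (at x) v)" for v
  proof (rule Suc.IH)
    show "Ck_on k S (\<lambda>x. frechet_derivative f (at x) v)" using Suc.prems(2) by simp
    show "frechet_derivative f (at x) v = frechet_derivative g (at x) v" if "x \<in> S" for x
      using frechet_derivative_at[OF D[OF that]] by (rule fun_cong)
  qed
  then show ?case using D by (auto simp: differentiable_def)
qed

text \<open>An affine inner map keeps the induction closed: the derivative of the composite in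
  direction \<open>v\<close> is the derivative of \<open>f\<close> in the fixed direction
  \<open>L v\<close>, composed with the same affine map. This makes coordinate lines of a chart
  smooth without a general chain rule for \<open>Ck_on\<close>.\<close>

lemma Ck_on_compose_affine:
  assumes L: "bounded_linear L" and "open T" "\<And>x. x \<in> T \<Longrightarrow> a + L x \<in> S" "Ck_on k S f"
  shows "Ck_on k T (\<lambda>x. f (a + L x))"
  using assms(4)
proof (induction k arbitrary: f)
  case 0
  then show ?case
    using assms(3) bounded_linear.continuous_on[OF L continuous_on_id]
    by (auto intro!: continuous_on_compose2[of S f] continuous_intros)
next
  case (Suc k)
  have D: "((\<lambda>x. f (a + L x)) has_derivative (\<lambda>h. frechet_derivative f (at (a + L x)) (L h))) (at x)"
    if "x \<in> T" for x
  proof -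
    have "(f has_derivative frechet_derivative f (at (a + L x))) (at (a + L x))"
      using Suc.prems assms(3)[OF that] by (auto simp: frechet_derivative_works)
    moreover have "((\<lambda>x. a + L x) has_derivative L) (at x)"
      using bounded_linear_imp_has_derivative[OF L] has_derivative_add[OF has_derivative_const]
      by fastforce
    ultimately show ?thesis by (rule has_derivative_compose[rotated])
  qed
  have "Ck_on k T (\<lambda>x. frechet_derivative (\<lambda>x. f (a + L x)) (at x) v)" for v
  proof (rule Ck_on_cong[OF \<open>open T\<close>])
    show "Ck_on k T (\<lambda>x. frechet_derivative f (at (a + L x)) (L v))"
      using Suc.prems by (intro Suc.IH[of "\<lambda>y. frechet_derivative f (at y) (L v)"]) auto
  qed (use frechet_derivative_at[OF D] in metis)
  then show ?case using D by (auto simp: differentiable_def)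
qed

lemma smooth_on_has_derivative:
  assumes "smooth_on S f" "x \<in> S"
  shows "(f has_derivative frechet_derivative f (at x)) (at x)"
proof -
  have "Ck_on (Suc 0) S f" using assms unfolding smooth_on_def by blast
  then show ?thesis using assms(2) by (auto simp: frechet_derivative_works)
qed

lemma smooth_on_frechet_derivative:
  assumes "smooth_on S f"
  shows "smooth_on S (\<lambda>x. frechet_derivative f (at x) v)"
  unfolding smooth_on_def
proof
  fix k
  have "Ck_on (Suc k) S f" using assms unfolding smooth_on_def by blast
  then show "Ck_on k S (\<lambda>x. frechet_derivative f (at x) v)" by simp
qed

lemma smooth_on_imp_continuous_on: "smooth_on S f \<Longrightarrow> continuous_on S f"
  unfolding smooth_on_def using Ck_on.simps(1) by blast

text \<open>Covers both \<open>cos, sin\<close> and \<open>cosh, sinh\<close>: such a combination is stable under differentiation.\<close>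

lemma smooth_on_combination:
  fixes p q :: "'a::real_normed_vector"
  assumes f: "\<And>t. (f has_real_derivative a * h t) (at t)"
    and h: "\<And>t. (h has_real_derivative b * f t) (at t)"
  shows "smooth_on S (\<lambda>t. f t *\<^sub>R p + h t *\<^sub>R q)"
  unfolding smooth_on_def
proof
  fix k
  \<comment> \<open>The derivative is written in the original shape, with \<open>p\<close> and
    \<open>q\<close> exchanged and rescaled. The induction hypothesis, general in \<open>p\<close>
    and \<open>q\<close>, then applies to it directly.\<close>
  have D: "((\<lambda>t. f t *\<^sub>R p + h t *\<^sub>R q) has_derivative
      (\<lambda>v. f t *\<^sub>R ((v * b) *\<^sub>R q) + h t *\<^sub>R ((v * a) *\<^sub>R p))) (at t)" for t and p q :: 'a
  proof -
    have "((\<lambda>t. f t *\<^sub>R p + h t *\<^sub>R q) has_derivative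
      (\<lambda>v. (a * h t * v) *\<^sub>R p + (b * f t * v) *\<^sub>R q)) (at t)"
      using f[of t] h[of t] unfolding has_field_derivative_def
      by (intro has_derivative_add has_derivative_scaleR_left)
    then show ?thesis by (simp add: algebra_simps)
  qed
  show "Ck_on k S (\<lambda>t. f t *\<^sub>R p + h t *\<^sub>R q)"
  proof (induction k arbitrary: p q)
    case 0
    show ?case
      using D has_derivative_continuous unfolding Ck_on.simps(1)
      by (blast intro: continuous_at_imp_continuous_on)
  next
    case (Suc k)
    have "Ck_on k S (\<lambda>x. frechet_derivative (\<lambda>t. f t *\<^sub>R p + h t *\<^sub>R q) (at x) v)" for v
      unfolding frechet_derivative_at[OF D, symmetric]
      using Suc[of "(v * b) *\<^sub>R q" "(v * a) *\<^sub>R p"] .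
    then show ?case using D unfolding Ck_on.simps differentiable_def by blast
  qed
qed

lemma has_derivative_zero_of_constant:
  assumes "(f has_derivative f') (at x)" "\<And>y. y \<in> T \<Longrightarrow> f y = c" "open T" "x \<in> T"
  shows "f' v = 0"
proof -
  have "((\<lambda>_. c) has_derivative f') (at x)"
    using assms(1,3,4) by (rule has_derivative_transform_within_open) (simp add: assms(2))
  from has_derivative_unique[OF this has_derivative_const] show ?thesis by simp
qed

lemma line_has_vector_derivative:
  fixes F :: "'a::real_normed_vector \<Rightarrow> 'b::real_normed_vector"
  assumes "(F has_derivative F') (at (u + s *\<^sub>R v))"
  shows "((\<lambda>t. F (u + t *\<^sub>R v)) has_vector_derivative F' v) (at s)"
proof -
  have "((\<lambda>t. u + t *\<^sub>R v) has_derivative (\<lambda>t. t *\<^sub>R v)) (at s)"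
    by (auto intro!: derivative_eq_intros)
  from has_derivative_compose[OF this assms]
  have "((\<lambda>t. F (u + t *\<^sub>R v)) has_derivative (\<lambda>t. F' (t *\<^sub>R v))) (at s)" .
  then show ?thesis
    using linear_cmul[OF has_derivative_linear[OF assms]] by (simp add: has_vector_derivative_def)
qed

section \<open>Symmetry of second derivatives\<close>

text \<open>Two mean value theorems: first in direction \<open>v\<close> for the
  \<open>w\<close>-difference \<open>\<phi>\<close>, then in direction \<open>w\<close> for the
  resulting difference of \<open>f' _ v\<close>. The second difference is symmetric in
  \<open>v\<close> and \<open>w\<close>, so exchanging them represents it by the other mixed
  derivative.\<close>

lemma second_difference_mean_value:
  fixes f :: "'a::real_normed_vector \<Rightarrow> real"
  assumes "h > 0"
    and U: "\<And>s t. 0 \<le> s \<Longrightarrow> s \<le> h \<Longrightarrow> 0 \<le> t \<Longrightarrow> t \<le> h \<Longrightarrow> u + s *\<^sub>R v + t *\<^sub>R w \<in> U"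
    and f: "\<And>x. x \<in> U \<Longrightarrow> (f has_derivative f' x) (at x)"
    and D: "\<And>x. x \<in> U \<Longrightarrow> ((\<lambda>y. f' y v) has_derivative D x) (at x)"
  obtains s t where "0 < s" "s < h" "0 < t" "t < h"
    "f (u + h *\<^sub>R v + h *\<^sub>R w) - f (u + h *\<^sub>R v) - f (u + h *\<^sub>R w) + f u
      = h * h * D (u + s *\<^sub>R v + t *\<^sub>R w) w"
proof -
  define \<phi> where "\<phi> s = f (u + s *\<^sub>R v + h *\<^sub>R w) - f (u + s *\<^sub>R v)" for s
  note line = line_has_vector_derivative[where 'b = real,
      folded has_real_derivative_iff_has_vector_derivative]
  have "(\<phi> has_real_derivative f' (u + s *\<^sub>R v + h *\<^sub>R w) v - f' (u + s *\<^sub>R v) v) (at s)"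
    if "0 \<le> s" "s \<le> h" for s
    unfolding \<phi>_def
    using line[OF f, of "u + h *\<^sub>R w" s v] line[OF f, of u s v] U[of s h] U[of s 0] that \<open>h > 0\<close>
    by (intro DERIV_diff) (auto simp: algebra_simps)
  from MVT2[OF \<open>h > 0\<close> this] obtain s where s: "0 < s" "s < h"
    "\<phi> h - \<phi> 0 = h * (f' (u + s *\<^sub>R v + h *\<^sub>R w) v - f' (u + s *\<^sub>R v) v)" by auto
  have "((\<lambda>t. f' (u + s *\<^sub>R v + t *\<^sub>R w) v) has_real_derivative D (u + s *\<^sub>R v + t *\<^sub>R w) w) (at t)"
    if "0 \<le> t" "t \<le> h" for t
    using s that by (intro line[where F = "\<lambda>y. f' y v"] D U) auto
  from MVT2[OF \<open>h > 0\<close> this] obtain t where t: "0 < t" "t < h"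
    "f' (u + s *\<^sub>R v + h *\<^sub>R w) v - f' (u + s *\<^sub>R v) v = h * D (u + s *\<^sub>R v + t *\<^sub>R w) w" by auto
  show ?thesis
    using that[OF s(1,2) t(1,2)] s(3) t(3) by (simp add: \<phi>_def)
qed

text \<open>Schwarz's theorem: both mixed derivatives, taken at suitable points of one small
  parallelogram, equal the same second difference divided by \<open>h * h\<close>. Continuity
  carries the equality over to \<open>u\<close>.\<close>

lemma real_second_derivatives_commute:
  fixes f :: "'a::real_normed_vector \<Rightarrow> real"
  assumes "open U" "u \<in> U"
    and f: "\<And>x. x \<in> U \<Longrightarrow> (f has_derivative f' x) (at x)"
    and D: "\<And>x. x \<in> U \<Longrightarrow> ((\<lambda>y. f' y v) has_derivative D x) (at x)"
    and E: "\<And>x. x \<in> U \<Longrightarrow> ((\<lambda>y. f' y w) has_derivative E x) (at x)"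
    and cD: "continuous_on U (\<lambda>x. D x w)" and cE: "continuous_on U (\<lambda>x. E x v)"
  shows "D u w = E u v"
proof (rule ccontr)
  assume "D u w \<noteq> E u v"
  \<comment> \<open>Half the gap: a common value within \<open>\<epsilon>\<close> of both numbers is
    then impossible.\<close>
  define \<epsilon> where "\<epsilon> = \<bar>D u w - E u v\<bar> / 2"
  have "\<epsilon> > 0" using \<open>D u w \<noteq> E u v\<close> by (simp add: \<epsilon>_def)
  obtain d0 where d0: "d0 > 0" "ball u d0 \<subseteq> U"
    using assms(1,2) open_contains_ball by blast
  obtain d1 where d1: "d1 > 0" "\<And>x. x \<in> U \<Longrightarrow> dist x u < d1 \<Longrightarrow> \<bar>D x w - D u w\<bar> < \<epsilon>"
    using cD \<open>\<epsilon> > 0\<close> \<open>u \<in> U\<close> unfolding continuous_on_iff dist_real_def by meson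
  obtain d2 where d2: "d2 > 0" "\<And>x. x \<in> U \<Longrightarrow> dist x u < d2 \<Longrightarrow> \<bar>E x v - E u v\<bar> < \<epsilon>"
    using cE \<open>\<epsilon> > 0\<close> \<open>u \<in> U\<close> unfolding continuous_on_iff dist_real_def by meson
  define d where "d = min d0 (min d1 d2)"
  \<comment> \<open>Keeps the whole parallelogram within distance \<open>d\<close> of
    \<open>u\<close>; the summand 1 covers \<open>v = w = 0\<close> and makes the bound
    strict.\<close>
  define h where "h = d / (norm v + norm w + 1)"
  have "d > 0" using d0 d1 d2 by (simp add: d_def)
  then have "h > 0" unfolding h_def by (simp add: add_nonneg_pos)
  have near: "dist (u + s *\<^sub>R v + t *\<^sub>R w) u < d" if "0 \<le> s" "s \<le> h" "0 \<le> t" "t \<le> h" for s t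
  proof -
    have "dist (u + s *\<^sub>R v + t *\<^sub>R w) u \<le> norm (s *\<^sub>R v) + norm (t *\<^sub>R w)"
      using norm_triangle_ineq[of "s *\<^sub>R v" "t *\<^sub>R w"] by (simp add: dist_norm)
    also have "\<dots> \<le> h * norm v + h * norm w"
      using that by (auto intro!: add_mono mult_right_mono)
    also have "\<dots> < h * (norm v + norm w + 1)"
      using \<open>h > 0\<close> by (simp add: algebra_simps)
    also have "\<dots> = d"
      unfolding h_def using norm_ge_zero[of v] norm_ge_zero[of w] by (simp add: add_nonneg_eq_0_iff)
    finally show ?thesis .
  qed
  have inU: "u + s *\<^sub>R v + t *\<^sub>R w \<in> U" if "0 \<le> s" "s \<le> h" "0 \<le> t" "t \<le> h" for s t
    using near[OF that] d0(2) by (auto simp: d_def dist_commute)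
  obtain s t where st: "0 < s" "s < h" "0 < t" "t < h"
    "f (u + h *\<^sub>R v + h *\<^sub>R w) - f (u + h *\<^sub>R v) - f (u + h *\<^sub>R w) + f u
      = h * h * D (u + s *\<^sub>R v + t *\<^sub>R w) w"
    using second_difference_mean_value[OF \<open>h > 0\<close> inU f D] by blast
  have inU': "u + t *\<^sub>R w + s *\<^sub>R v \<in> U" if "0 \<le> t" "t \<le> h" "0 \<le> s" "s \<le> h" for s t
    using inU[of s t] that by (simp add: add.assoc add.commute add.left_commute)
  obtain t' s' where st': "0 < t'" "t' < h" "0 < s'" "s' < h"
    "f (u + h *\<^sub>R w + h *\<^sub>R v) - f (u + h *\<^sub>R w) - f (u + h *\<^sub>R v) + f u
      = h * h * E (u + t' *\<^sub>R w + s' *\<^sub>R v) v"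
    using second_difference_mean_value[OF \<open>h > 0\<close> inU' f E] by blast
  define x where "x = u + s *\<^sub>R v + t *\<^sub>R w"
  define y where "y = u + s' *\<^sub>R v + t' *\<^sub>R w"
  have "u + h *\<^sub>R w + h *\<^sub>R v = u + h *\<^sub>R v + h *\<^sub>R w" "u + t' *\<^sub>R w + s' *\<^sub>R v = y"
    by (simp_all add: y_def)
  note swap = this
  have "h * h * D x w = h * h * E y v"
    using st(5) st'(5) unfolding x_def swap by linarith
  then have "D x w = E y v" using \<open>h > 0\<close> by simp
  moreover have "\<bar>D x w - D u w\<bar> < \<epsilon>"
    unfolding x_def using inU[of s t] near[of s t] st by (intro d1(2)) (auto simp: d_def)
  moreover have "\<bar>E y v - E u v\<bar> < \<epsilon>"
    unfolding y_def using inU[of s' t'] near[of s' t'] st' by (intro d2(2)) (auto simp: d_def)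
  ultimately show False unfolding \<epsilon>_def by (smt (verit) field_sum_of_halves)
qed

text \<open>The mean value argument is scalar, so it is applied to each coordinate
  \<open>f x \<bullet> b\<close>.\<close>

lemma smooth_on_second_derivatives_commute:
  fixes f :: "'a::real_normed_vector \<Rightarrow> 'b::euclidean_space"
  assumes "open U" "u \<in> U" "smooth_on U f"
  shows "frechet_derivative (\<lambda>y. frechet_derivative f (at y) v) (at u) w =
         frechet_derivative (\<lambda>y. frechet_derivative f (at y) w) (at u) v"
proof (rule euclidean_eqI)
  fix b :: 'b
  let ?D = "\<lambda>v x. frechet_derivative (\<lambda>y. frechet_derivative f (at y) v) (at x)"
  note sm = smooth_on_frechet_derivative[OF \<open>smooth_on U f\<close>]
  show "?D v u w \<bullet> b = ?D w u v \<bullet> b"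
  proof (rule real_second_derivatives_commute[OF assms(1,2),
        where f = "\<lambda>x. f x \<bullet> b" and f' = "\<lambda>x h. frechet_derivative f (at x) h \<bullet> b"
          and D = "\<lambda>x h. ?D v x h \<bullet> b" and E = "\<lambda>x h. ?D w x h \<bullet> b"])
    show "((\<lambda>x. f x \<bullet> b) has_derivative (\<lambda>h. frechet_derivative f (at x) h \<bullet> b)) (at x)"
      if "x \<in> U" for x
      using smooth_on_has_derivative[OF assms(3) that] by (rule has_derivative_inner_left)
    show "((\<lambda>y. frechet_derivative f (at y) v \<bullet> b) has_derivative (\<lambda>h. ?D v x h \<bullet> b)) (at x)"
      if "x \<in> U" for x v
      using smooth_on_has_derivative[OF sm that] by (rule has_derivative_inner_left)
    then show "((\<lambda>y. frechet_derivative f (at y) w \<bullet> b) has_derivative (\<lambda>h. ?D w x h \<bullet> b)) (at x)"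
      if "x \<in> U" for x using that by blast
    show "continuous_on U (\<lambda>x. ?D v x w \<bullet> b)" "continuous_on U (\<lambda>x. ?D w x v \<bullet> b)"
      by (intro continuous_on_inner continuous_on_const smooth_on_imp_continuous_on
          smooth_on_frechet_derivative sm)+
  qed
qed

section \<open>Parallel fields along surfaces in space forms\<close>

lemma unit_field_along_smooth_on:
  "unit_field_along g M S V \<Longrightarrow> local_parametrization S U W X \<Longrightarrow> smooth_on U (\<lambda>u. V (X u))"
  by (simp add: unit_field_along_def smooth_along_def)

lemma tangent_space_mono:
  assumes "S \<subseteq> M"
  shows "tangent_space S p \<subseteq> tangent_space M p"
  unfolding tangent_space_def
proof (intro Collect_mono impI, elim exE)
  fix v c e
  assume "0 < e \<and> smooth_on {-e<..<e} c \<and> c ` {-e<..<e} \<subseteq> S \<and> c (0::real) = p \<and>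
    (c has_vector_derivative v) (at 0)"
  then show "\<exists>c e. 0 < e \<and> smooth_on {-e<..<e} c \<and> c ` {-e<..<e} \<subseteq> M \<and> c (0::real) = p \<and>
    (c has_vector_derivative v) (at 0)"
    using assms order_trans by (intro exI[of _ c] exI[of _ e]) (auto)
qed

section \<open>Linear algebra of a space form in its ambient vector space\<close>

text \<open>Treats both models at once, with \<open>k\<close> equal to plus or minus the squared
  radius. Only \<open>positive\<close> asks for definiteness, and only on the hyperplane orthogonal
  to \<open>p\<close>, since the Lorentz form is indefinite. \<open>tangent_spaceI\<close> is the
  inclusion that needs explicit curves in each model.\<close>

locale space_form = bounded_bilinear g for g :: "'a::euclidean_space \<Rightarrow> 'a \<Rightarrow> real" +
  fixes M :: "'a set" and k :: real
  assumes sym: "g x y = g y x"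
    and k_nonzero: "k \<noteq> 0"
    and on_M: "p \<in> M \<Longrightarrow> g p p = k"
    and tangent_spaceI: "p \<in> M \<Longrightarrow> g v p = 0 \<Longrightarrow> v \<in> tangent_space M p"
    and positive: "p \<in> M \<Longrightarrow> g v p = 0 \<Longrightarrow> v \<noteq> 0 \<Longrightarrow> g v v > 0"
begin

text \<open>Differentiating the constant \<open>g (c t) (c t)\<close> along a curve makes its
  velocity orthogonal to the position vector; the converse is \<open>tangent_spaceI\<close>.\<close>

lemma tangent_space_eq:
  assumes "p \<in> M"
  shows "tangent_space M p = {v. g v p = 0}"
proof (intro equalityI subsetI CollectI)
  fix v assume "v \<in> tangent_space M p"
  then obtain c e where c: "e > 0" "c ` {-e<..<e} \<subseteq> M" "c 0 = p" "(c has_derivative (\<lambda>h. h *\<^sub>R v)) (at 0)"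
    unfolding tangent_space_def has_vector_derivative_def by blast
  have D: "((\<lambda>t. g (c t) (c t)) has_derivative (\<lambda>h. g p (h *\<^sub>R v) + g (h *\<^sub>R v) p)) (at 0)"
    using FDERIV[OF c(4) c(4)] c(3) by simp
  have const: "g (c t) (c t) = k" if "t \<in> {-e<..<e}" for t
    using that c(2) by (intro on_M) auto
  have "g p v + g v p = 0"
    using has_derivative_zero_of_constant[OF D, where T = "{-e<..<e}" and c = k and v = 1] const c(1)
    by simp
  then show "g v p = 0" using sym[of v p] by simp
qed (use assms tangent_spaceI in auto)

text \<open>The position vector spans the normal direction and has square \<open>k\<close>, so its
  component is subtracted. This makes the covariant derivative explicit.\<close>

lemma tangential_part_eq:
  assumes "p \<in> M"
  shows "tangential_part g (tangent_space M p) w = w - (g w p / k) *\<^sub>R p"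
  unfolding tangential_part_def
proof (rule the_equality)
  let ?u = "w - (g w p / k) *\<^sub>R p"
  have u: "g ?u p = 0"
    using on_M[OF assms] k_nonzero by (simp add: diff_left scaleR_left)
  then show "?u \<in> tangent_space M p \<and> (\<forall>z\<in>tangent_space M p. g (w - ?u) z = 0)"
    using sym[of p] by (auto simp: tangent_space_eq[OF assms] scaleR_left)
  fix u assume "u \<in> tangent_space M p \<and> (\<forall>z\<in>tangent_space M p. g (w - u) z = 0)"
  then have u': "g u p = 0" and orth: "\<And>z. g z p = 0 \<Longrightarrow> g (w - u) z = 0"
    by (auto simp: tangent_space_eq[OF assms])
  have 1: "g (?u - u) p = 0" using u u' by (simp add: diff_left)
  \<comment> \<open>Uniqueness: the difference of two candidates is tangent and orthogonal to
    itself, so \<open>positive\<close> makes it zero.\<close>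
  have "g (?u - u) (?u - u) = g (w - u) (?u - u) - (g w p / k) * g p (?u - u)"
    by (simp add: diff_left scaleR_left)
  also have "\<dots> = 0" using orth[OF 1] 1 sym[of p "?u - u"] by simp
  finally show "u = ?u" using positive[OF assms 1] by force
qed

text \<open>The vectors orthogonal to \<open>a\<close> form a subspace, which omits \<open>a\<close>
  when \<open>a\<close> is not null. For an indefinite form this adds independent vectors one at a
  time.\<close>

lemma not_in_span_orthogonal:
  assumes "\<And>b. b \<in> B \<Longrightarrow> g b a = 0" "g a a \<noteq> 0"
  shows "a \<notin> span B"
proof
  assume "a \<in> span B"
  moreover have "subspace {x. g x a = 0}"
    by (auto simp: subspace_def zero_left add_left scaleR_left)
  then have "span B \<subseteq> {x. g x a = 0}"
    using assms(1) by (intro span_minimal) auto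
  ultimately show False using assms(2) by auto
qed

text \<open>In dimension 4 the vectors orthogonal to \<open>p\<close>, \<open>a\<close> and
  \<open>b\<close> form a line, so a unit vector there is determined up to sign.\<close>

lemma unit_normals_eq:
  assumes dim: "DIM('a) = 4" and "p \<in> M"
    and ab: "independent {a, b}" "a \<noteq> b" "g a p = 0" "g b p = 0"
    and v: "g v p = 0" "g a v = 0" "g b v = 0" "g v v = 1"
    and n: "g n p = 0" "g a n = 0" "g b n = 0" "g n n = 1"
  shows "v = n \<or> v = - n"
proof -
  \<comment> \<open>The part of \<open>v\<close> orthogonal to \<open>n\<close>. If nonzero, it is
    not null by \<open>positive\<close>, and \<open>z, n, p, a, b\<close> would be five independent
    vectors.\<close>
  define z where "z = v - g v n *\<^sub>R n"
  have z: "g z p = 0" "g p z = 0" "g a z = 0" "g b z = 0" "g n z = 0"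
    using v n sym[of p] sym[of n v]
    by (simp_all add: z_def diff_left scaleR_left diff_right scaleR_right)
  have "z = 0"
  proof (rule ccontr)
    assume "z \<noteq> 0"
    then have "g z z \<noteq> 0" using positive[OF \<open>p \<in> M\<close> z(1)] by simp
    then have z_new: "z \<notin> span {n, p, a, b}"
      using z by (intro not_in_span_orthogonal) auto
    have n_new: "n \<notin> span {p, a, b}"
      using n sym[of p n] by (intro not_in_span_orthogonal) auto
    have p_new: "p \<notin> span {a, b}"
      using ab on_M[OF \<open>p \<in> M\<close>] k_nonzero by (intro not_in_span_orthogonal) auto
    have "independent {z, n, p, a, b}"
      by (intro independent_insertI[OF z_new] independent_insertI[OF n_new]
          independent_insertI[OF p_new] ab(1))
    then have "card {z, n, p, a, b} \<le> 4"
      using independent_bound dim by fastforce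
    moreover have "z \<notin> {n, p, a, b}" "n \<notin> {p, a, b}" "p \<notin> {a, b}"
      using z_new n_new p_new by (meson span_base)+
    ultimately show False using \<open>a \<noteq> b\<close> by simp
  qed
  then have v_eq: "v = g v n *\<^sub>R n" by (simp add: z_def)
  then have "g v v = g v n * g v n" 
    by (metis scaleR_right real_scaleR_def)
  then have "g v n = 1 \<or> g v n = - 1" using v(4) square_eq_1_iff by metis
  then show ?thesis using v_eq by (metis scaleR_one scaleR_minus1_left)
qed

section \<open>Charts of the surface and parallel fields in coordinates\<close>

context
  fixes S U W X
  assumes X: "local_parametrization S U W X" and S: "S \<subseteq> M"
begin

lemma chart_in: "u \<in> U \<Longrightarrow> X u \<in> S"
  using X unfolding local_parametrization_def homeomorphism_def by blast

lemma chart_has_derivative: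
  "u \<in> U \<Longrightarrow> (X has_derivative frechet_derivative X (at u)) (at u)"
  using X by (intro smooth_on_has_derivative[of U]) (simp_all add: local_parametrization_def)

text \<open>Supplies the test curves: they realise the vectors
  \<open>frechet_derivative X (at u) v\<close> as tangent vectors of \<open>S\<close>, and
  parallelism is evaluated along them.\<close>

lemma coordinate_line:
  assumes "u \<in> U"
  obtains e where "e > 0" "smooth_on {-e<..<e} (\<lambda>t::real. X (u + t *\<^sub>R v))"
    "(\<lambda>t. X (u + t *\<^sub>R v)) ` {-e<..<e} \<subseteq> S"
proof -
  have XU: "open U" "smooth_on U X" using X by (auto simp: local_parametrization_def)
  have "open ((\<lambda>t::real. u + t *\<^sub>R v) -` U)"
    by (intro open_vimage XU(1) continuous_intros)
  then obtain e where e: "e > 0" "ball 0 e \<subseteq> (\<lambda>t::real. u + t *\<^sub>R v) -` U"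
    using assms by (auto elim: openE[where x = 0])
  then have line: "u + t *\<^sub>R v \<in> U" if "t \<in> {-e<..<e}" for t
    using that subsetD[OF e(2), of t] by (simp add: dist_norm abs_less_iff)
  have "smooth_on {-e<..<e} (\<lambda>t::real. X (u + t *\<^sub>R v))"
    unfolding smooth_on_def
  proof
    fix k
    have "Ck_on k U X" using XU(2) unfolding smooth_on_def by blast
    then show "Ck_on k {-e<..<e} (\<lambda>t::real. X (u + t *\<^sub>R v))"
      using line by (intro Ck_on_compose_affine[OF bounded_linear_scaleR_left, where S = U]) simp_all
  qed
  then show ?thesis using that e(1) line chart_in by blast
qed

lemma chart_derivative_tangent:
  assumes "u \<in> U"
  shows "frechet_derivative X (at u) v \<in> tangent_space S (X u)"
proof -
  obtain e where e: "e > 0" "smooth_on {-e<..<e} (\<lambda>t::real. X (u + t *\<^sub>R v))"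
    "(\<lambda>t. X (u + t *\<^sub>R v)) ` {-e<..<e} \<subseteq> S"
    by (rule coordinate_line[OF assms, of v])
  show ?thesis
    unfolding tangent_space_def mem_Collect_eq
    using e line_has_vector_derivative[where s = 0, simplified, OF chart_has_derivative[OF assms]]
    by (intro exI[of _ "\<lambda>t. X (u + t *\<^sub>R v)"] exI[of _ e]) auto
qed

lemma chart_derivative_orthogonal:
  assumes "u \<in> U"
  shows "g (frechet_derivative X (at u) v) (X u) = 0"
proof -
  have "X u \<in> M" using chart_in[OF assms] S by blast
  then show ?thesis
    using subsetD[OF tangent_space_mono[OF S] chart_derivative_tangent[OF assms, of v]]
    by (simp add: tangent_space_eq)
qed

text \<open>The ambient derivative of a parallel field is normal to \<open>M\<close>, hence a multiple of the position
  vector; the factor comes from differentiating \<open>g (V (X u)) (X u) = 0\<close>.\<close>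

lemma parallel_derivative:
  assumes V: "unit_field_along g M S V" "parallel_along g M S V" and u: "u \<in> U"
  shows "frechet_derivative (\<lambda>u. V (X u)) (at u) v =
    - (g (V (X u)) (frechet_derivative X (at u) v) / k) *\<^sub>R X u"
proof -
  let ?F = "\<lambda>u. V (X u)" and ?F' = "frechet_derivative (\<lambda>u. V (X u)) (at u)"
    and ?X' = "frechet_derivative X (at u)"
  have "smooth_on U ?F"
    using unit_field_along_smooth_on[OF V(1) X] .
  then have F: "(?F has_derivative ?F') (at u)"
    using u by (rule smooth_on_has_derivative)
  obtain e where e: "e > 0" "smooth_on {-e<..<e} (\<lambda>t::real. X (u + t *\<^sub>R v))"
    "(\<lambda>t. X (u + t *\<^sub>R v)) ` {-e<..<e} \<subseteq> S"
    by (rule coordinate_line[OF u, of v])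
  have "0 \<in> {-e<..<e}" using e(1) by simp
  then have "covariant_derivative g M (\<lambda>t. X (u + t *\<^sub>R v)) (\<lambda>s. ?F (u + s *\<^sub>R v)) 0 = 0"
    using V(2)[unfolded parallel_along_def, rule_format, OF conjI[OF e(2,3)]] by blast
  moreover have "X u \<in> M" using chart_in[OF u] S by blast
  ultimately have F'_eq: "?F' v = (g (?F' v) (X u) / k) *\<^sub>R X u"
    by (simp add: covariant_derivative_def tangential_part_eq
        vector_derivative_at[OF line_has_vector_derivative[where s = 0, simplified, OF F]])
  have D: "((\<lambda>u. g (?F u) (X u)) has_derivative (\<lambda>h. g (?F u) (?X' h) + g (?F' h) (X u))) (at u)"
    using FDERIV[OF F chart_has_derivative[OF u]] .
  have const: "g (?F y) (X y) = 0" if "y \<in> U" for y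
  proof -
    have "X y \<in> M" "V (X y) \<in> tangent_space M (X y)"
      using V(1) chart_in[OF that] S unfolding unit_field_along_def by auto
    then show ?thesis by (simp add: tangent_space_eq)
  qed
  have "open U" using X by (simp add: local_parametrization_def)
  then have "g (?F u) (?X' v) + g (?F' v) (X u) = 0"
    using has_derivative_zero_of_constant[OF D, where T = U and c = 0 and v = v] const u by simp
  then have "g (?F' v) (X u) = - g (?F u) (?X' v)"
    by simp
  with F'_eq show ?thesis by simp
qed

text \<open>In the equality of the mixed second derivatives of \<open>V \<circ> X\<close> all terms cancel
  except the following ones.\<close>

lemma parallel_integrability:
  assumes V: "unit_field_along g M S V" "parallel_along g M S V" and u: "u \<in> U"
  defines "X' \<equiv> frechet_derivative X (at u)"
  shows "g (V (X u)) (X' v) *\<^sub>R X' w = g (V (X u)) (X' w) *\<^sub>R X' v"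
proof -
  let ?F = "\<lambda>u. V (X u)" and ?F' = "frechet_derivative (\<lambda>u. V (X u)) (at u)"
  let ?X2 = "\<lambda>v. frechet_derivative (\<lambda>y. frechet_derivative X (at y) v) (at u)"
  have XU: "open U" "smooth_on U X" using X by (auto simp: local_parametrization_def)
  have smF: "smooth_on U ?F"
    using unit_field_along_smooth_on[OF V(1) X] .
  have F: "(?F has_derivative ?F') (at u)"
    using smooth_on_has_derivative[OF smF u] .
  have eq: "frechet_derivative (\<lambda>y. frechet_derivative ?F (at y) v) (at u) w =
    - ((g (?F u) (?X2 v w) / k) *\<^sub>R X u + (g (?F u) (X' v) / k) *\<^sub>R X' w)" for v w
  proof -
    have "((\<lambda>y. g (?F y) (frechet_derivative X (at y) v)) has_derivative
        (\<lambda>h. g (?F u) (?X2 v h) + g (?F' h) (X' v))) (at u)"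
      unfolding X'_def
      by (rule FDERIV[OF F smooth_on_has_derivative[OF smooth_on_frechet_derivative[OF XU(2)] u]])
    \<comment> \<open>The derivative of the field is a multiple of \<open>X u\<close>, which is
      orthogonal to \<open>X' v\<close>; hence this product-rule term drops out.\<close>
    moreover have "g (?F' h) (X' v) = 0" for h
      using chart_derivative_orthogonal[OF u, of v] sym[of "X u" "X' v"]
      by (simp add: parallel_derivative[OF V u] scaleR_left X'_def minus_left)
    ultimately have "((\<lambda>y. g (?F y) (frechet_derivative X (at y) v)) has_derivative
        (\<lambda>h. g (?F u) (?X2 v h))) (at u)" by simp
    from has_derivative_scaleR[OF has_derivative_mult_right[OF this, of "- 1 / k"]
        chart_has_derivative[OF u]]
    have "((\<lambda>y. - (g (?F y) (frechet_derivative X (at y) v) / k) *\<^sub>R X y) has_derivative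
        (\<lambda>h. - ((g (?F u) (?X2 v h) / k) *\<^sub>R X u + (g (?F u) (X' v) / k) *\<^sub>R X' h))) (at u)"
      by (simp add: X'_def algebra_simps)
    then have "((\<lambda>y. frechet_derivative ?F (at y) v) has_derivative
        (\<lambda>h. - ((g (?F u) (?X2 v h) / k) *\<^sub>R X u + (g (?F u) (X' v) / k) *\<^sub>R X' h))) (at u)"
      using XU(1) u parallel_derivative[OF V]
      by (elim has_derivative_transform_within_open[where s = U]) auto
    from frechet_derivative_at[OF this, symmetric] show ?thesis by simp
  qed
  \<comment> \<open>Symmetry is used twice: for the field to equate the two expressions, and for
    \<open>X\<close> to cancel the terms with \<open>?X2\<close>.\<close>
  have "(1 / k) *\<^sub>R (g (?F u) (X' v) *\<^sub>R X' w) = (1 / k) *\<^sub>R (g (?F u) (X' w) *\<^sub>R X' v)"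
    using smooth_on_second_derivatives_commute[OF XU(1) u smF, of v w]
      smooth_on_second_derivatives_commute[OF XU(1) u XU(2), of v w]
    by (simp add: eq)
  then show ?thesis
    using k_nonzero by (metis scaleR_cancel_left divide_eq_0_iff zero_neq_one)
qed

end

text \<open>One point suffices: the angle is constant and a \<open>regular_surface\<close> is
  nonempty.\<close>

lemma constant_parallel_angle_trivial:
  assumes dim: "DIM('a) = 4" and angle: "constant_parallel_angle g M S \<nu> V \<theta>"
  shows "\<theta> \<in> {0, pi}"
proof -
  have S: "regular_surface S" "S \<subseteq> M" and \<nu>: "unit_normal g M S \<nu>"
    and V: "unit_field_along g M S V" "parallel_along g M S V"
    and \<theta>: "\<And>p. p \<in> S \<Longrightarrow> metric_angle g (V p) (\<nu> p) = \<theta>"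
    using angle unfolding constant_parallel_angle_def by auto
  obtain p U W X where p: "p \<in> S" "p \<in> W" and X: "local_parametrization S U W X"
    using S(1) unfolding regular_surface_def by blast
  have "p \<in> X ` U"
    using p X unfolding local_parametrization_def homeomorphism_def by auto
  then obtain u where u: "u \<in> U" "p = X u" by blast
  have pM: "p \<in> M" using p S by blast
  define X' where "X' = frechet_derivative X (at u)"
  have lin: "linear X'"
    unfolding X'_def using has_derivative_linear[OF chart_has_derivative[OF X S(2) u(1)]] .
  have inj: "inj X'" using X u(1) unfolding local_parametrization_def X'_def by blast
  define e1 e2 :: "real^2" where "e1 = axis 1 1" and "e2 = axis 2 1"
  have e: "e1 $ 1 = 1" "e1 $ 2 = 0" "e2 $ 1 = 0" "e2 $ 2 = 1"
    by (simp_all add: e1_def e2_def axis_def)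
  \<comment> \<open>The coefficients are moved inside \<open>X'\<close>, so that injectivity reduces
    the claim to comparing coordinates in the plane.\<close>
  have "X' (g (V p) (X' e1) *\<^sub>R e2) = X' (g (V p) (X' e2) *\<^sub>R e1)"
    using parallel_integrability[OF X S(2) V u(1), of e1 e2, folded X'_def u(2)]
    by (simp add: linear_cmul[OF lin])
  then have "g (V p) (X' e1) *\<^sub>R e2 = g (V p) (X' e2) *\<^sub>R e1"
    using inj by (auto dest: injD)
  then have "(g (V p) (X' e1) *\<^sub>R e2) $ i = (g (V p) (X' e2) *\<^sub>R e1) $ i" for i by simp
  from this[of 1] this[of 2] have V_orth: "g (X' e1) (V p) = 0" "g (X' e2) (V p) = 0"
    using e sym[of "V p"] by simp_all
  have \<nu>_orth: "g (X' v) (\<nu> p) = 0" for v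
    using \<nu> chart_derivative_tangent[OF X S(2) u(1), of v] p u(2) sym[of "\<nu> p"]
    unfolding unit_normal_def X'_def by auto
  have X_orth: "g (X' v) p = 0" for v
    using chart_derivative_orthogonal[OF X S(2) u(1)] u(2) by (simp add: X'_def)
  have "e1 \<noteq> e2" using e by auto
  have "e1 \<in> Basis" "e2 \<in> Basis" by (auto simp: e1_def e2_def axis_in_Basis_iff)
  then have "independent {e1, e2}"
    using independent_mono[OF independent_Basis, of "{e1, e2}"] by simp
  then have "independent (X' ` {e1, e2})"
    using lin inj by (intro linear_independent_injective_image) (auto intro: inj_on_subset)
  then have "independent {X' e1, X' e2}" by simp
  moreover have "X' e1 \<noteq> X' e2" using inj \<open>e1 \<noteq> e2\<close> by (auto dest: injD)
  moreover have "g (V p) p = 0" "g (V p) (V p) = 1"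
    using V(1) p tangent_space_eq[OF pM] by (auto simp: unit_field_along_def)
  moreover have \<nu>_unit: "g (\<nu> p) p = 0" "g (\<nu> p) (\<nu> p) = 1"
    using \<nu> p tangent_space_eq[OF pM] by (auto simp: unit_normal_def unit_field_along_def)
  ultimately have "V p = \<nu> p \<or> V p = - \<nu> p"
    using unit_normals_eq[OF dim pM] X_orth V_orth \<nu>_orth by metis
  \<comment> \<open>The quotient inside \<open>arccos\<close> is now 1 or -1.\<close>
  then have "metric_angle g (V p) (\<nu> p) \<in> {0, pi}"
    using \<nu>_unit by (auto simp: metric_angle_def minus_left minus_right)
  then show ?thesis using \<theta>[OF p(1)] by simp
qed

end

section \<open>The sphere and the hyperboloid as space forms\<close>

text \<open>The curve starts at \<open>p\<close>, and its velocity there is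
  \<open>b *\<^sub>R q\<close> because \<open>h 0 = 0\<close> removes the \<open>p\<close> term. It
  serves for great circles and for their hyperbolic analogues.\<close>

lemma combination_tangent:
  fixes p q :: "'a::euclidean_space"
  assumes f: "\<And>t. (f has_real_derivative a * h t) (at t)"
    and h: "\<And>t. (h has_real_derivative b * f t) (at t)"
    and 0: "f 0 = 1" "h 0 = 0" and "e > 0"
    and M: "\<And>t. t \<in> {-e<..<e} \<Longrightarrow> f t *\<^sub>R p + h t *\<^sub>R q \<in> M"
  shows "b *\<^sub>R q \<in> tangent_space M p"
proof -
  have "((\<lambda>t. f t *\<^sub>R p + h t *\<^sub>R q) has_vector_derivative b *\<^sub>R q) (at 0)"
    using f[of 0] h[of 0] 0 by (auto intro!: derivative_eq_intros)
  then show ?thesis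
    unfolding tangent_space_def mem_Collect_eq
    using smooth_on_combination[OF f h] M 0 \<open>e > 0\<close>
    by (intro exI[of _ "\<lambda>t. f t *\<^sub>R p + h t *\<^sub>R q"] exI[of _ e]) auto
qed

lemma space_form_sphere:
  assumes "r > 0"
  shows "space_form (\<bullet>) (sphere (0 :: 'a::euclidean_space) r) (r\<^sup>2)"
proof (intro space_form.intro space_form_axioms.intro bounded_bilinear_inner)
  fix p v :: 'a
  assume p: "p \<in> sphere 0 r"
  then show pp: "p \<bullet> p = r\<^sup>2" by (simp add: dot_square_norm)
  assume vp: "v \<bullet> p = 0"
  show "v \<in> tangent_space (sphere 0 r) p"
  proof -
    \<comment> \<open>Angular speed of the great circle with velocity \<open>v\<close>;
      \<open>q\<close> then has length \<open>r\<close>. For \<open>v = 0\<close> both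
      \<open>\<omega>\<close> and \<open>q\<close> are 0 and the curve is constant.\<close>
    define \<omega> where "\<omega> = norm v / r"
    define q where "q = (1 / \<omega>) *\<^sub>R v"
    have "\<omega> *\<^sub>R q = v" using \<open>r > 0\<close> by (simp add: q_def \<omega>_def)
    have "cos (\<omega> * t) *\<^sub>R p + sin (\<omega> * t) *\<^sub>R q \<in> sphere 0 r" for t
    proof (cases "v = 0")
      case True
      then show ?thesis using p by (simp add: \<omega>_def q_def)
    next
      case False
      then have qq: "q \<bullet> q = r\<^sup>2"
        using \<open>r > 0\<close> by (simp add: q_def \<omega>_def dot_square_norm power2_eq_square)
      have pq: "p \<bullet> q = 0" using vp by (simp add: q_def inner_commute)
      let ?c = "cos (\<omega> * t) *\<^sub>R p + sin (\<omega> * t) *\<^sub>R q"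
      have "(norm ?c)\<^sup>2 = ((cos (\<omega> * t))\<^sup>2 + (sin (\<omega> * t))\<^sup>2) * r\<^sup>2"
        unfolding power2_norm_eq_inner
        by (simp add: inner_add_left inner_add_right pp qq pq inner_commute[of q p]
            power2_eq_square algebra_simps
            \<comment> \<open>Kept out so that the sum of squares is not collapsed to 1 before both
              sides are expanded and compared.\<close>
            del: sin_cos_squared_add sin_cos_squared_add2 sin_cos_squared_add3)
      then have "(norm ?c)\<^sup>2 = r\<^sup>2" by simp
      then show ?thesis using \<open>r > 0\<close> by simp
    qed
    then have "\<omega> *\<^sub>R q \<in> tangent_space (sphere 0 r) p"
      by (intro combination_tangent[where f = "\<lambda>t. cos (\<omega> * t)" and h = "\<lambda>t. sin (\<omega> * t)"
            and a = "- \<omega>" and e = 1]) (auto intro!: derivative_eq_intros)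
    then show ?thesis using \<open>\<omega> *\<^sub>R q = v\<close> by simp
  qed
qed (use \<open>r > 0\<close> in \<open>auto simp: inner_commute\<close>)

lemma bounded_bilinear_lorentz: "bounded_bilinear lorentz"
  unfolding bilinear_conv_bounded_bilinear[symmetric] bilinear_def
  by (intro conjI allI linearI)
     (simp_all add: lorentz_def inner_add_left inner_add_right algebra_simps)

text \<open>The complement of a timelike vector is spacelike: orthogonality to \<open>p\<close>
  expresses \<open>fst v * fst p\<close> as a Euclidean product, which Cauchy-Schwarz
  bounds.\<close>

lemma lorentz_positive:
  assumes "r > 0" and p: "p \<in> hyperbolic_space r" and vp: "lorentz v p = 0" and "v \<noteq> 0"
  shows "lorentz v v > 0"
proof -
  have pp: "snd p \<bullet> snd p = (fst p)\<^sup>2 - r\<^sup>2" and p0: "fst p > 0"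
    using p by (auto simp: hyperbolic_space_def lorentz_def power2_eq_square)
  have eq: "fst v * fst p = snd v \<bullet> snd p" using vp by (simp add: lorentz_def)
  show ?thesis
  proof (cases "snd v = 0")
    case True
    then have "fst v = 0" using eq p0 by simp
    with True \<open>v \<noteq> 0\<close> show ?thesis by (simp add: prod_eq_iff)
  next
    case False
    then have vv: "snd v \<bullet> snd v > 0" by simp
    have "(fst v)\<^sup>2 * (fst p)\<^sup>2 = (snd v \<bullet> snd p)\<^sup>2"
      by (simp add: eq[symmetric] power_mult_distrib)
    also have "\<dots> \<le> (snd v \<bullet> snd v) * ((fst p)\<^sup>2 - r\<^sup>2)"
      using Cauchy_Schwarz_ineq[of "snd v" "snd p"] by (simp add: pp)
    \<comment> \<open>Strictness comes from \<open>r > 0\<close> together with \<open>snd v\<close>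
      being nonzero.\<close>
    also have "\<dots> < (snd v \<bullet> snd v) * (fst p)\<^sup>2"
      using vv \<open>r > 0\<close> by (intro mult_strict_left_mono) auto
    finally have "(fst v)\<^sup>2 < snd v \<bullet> snd v"
      using p0 by simp
    then show ?thesis by (simp add: lorentz_def power2_eq_square)
  qed
qed

lemma space_form_hyperbolic:
  assumes "r > 0"
  shows "space_form lorentz (hyperbolic_space r) (- r\<^sup>2)"
proof (intro space_form.intro space_form_axioms.intro bounded_bilinear_lorentz)
  interpret L: bounded_bilinear lorentz by (rule bounded_bilinear_lorentz)
  show sym: "lorentz x y = lorentz y x" for x y
    by (simp add: lorentz_def inner_commute mult.commute)
  fix p v
  assume p: "p \<in> hyperbolic_space r"
  then show pp: "lorentz p p = - r\<^sup>2" by (simp add: hyperbolic_space_def)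
  assume vp: "lorentz v p = 0"
  then show "v \<noteq> 0 \<Longrightarrow> lorentz v v > 0"
    using lorentz_positive[OF \<open>r > 0\<close> p] by blast
  then have vv: "lorentz v v \<ge> 0" by (cases "v = 0") (auto simp: L.zero_left)
  \<comment> \<open>As on the sphere, \<open>q\<close> is scaled to square \<open>r\<^sup>2\<close>
    when \<open>v\<close> is nonzero, and the curve is constant when \<open>v = 0\<close>.\<close>
  define \<omega> where "\<omega> = sqrt (lorentz v v) / r"
  define q where "q = (1 / \<omega>) *\<^sub>R v"
  let ?c = "\<lambda>t. cosh (\<omega> * t) *\<^sub>R p + sinh (\<omega> * t) *\<^sub>R q"
  have \<omega>: "\<omega> \<noteq> 0" if "v \<noteq> 0"
    using lorentz_positive[OF \<open>r > 0\<close> p vp that] \<open>r > 0\<close> by (simp add: \<omega>_def)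
  then have "\<omega> *\<^sub>R q = v" by (cases "v = 0") (auto simp: q_def)
  have c: "lorentz (?c t) (?c t) = - r\<^sup>2" for t
  proof (cases "v = 0")
    case True
    then show ?thesis using pp by (simp add: \<omega>_def q_def L.zero_left)
  next
    case False
    have "lorentz q q = lorentz v v / \<omega>\<^sup>2"
      by (simp add: q_def L.scaleR_left L.scaleR_right power2_eq_square)
    also have "\<dots> = r\<^sup>2"
      using \<omega>[OF False] vv \<open>r > 0\<close> by (auto simp: \<omega>_def power_divide)
    finally have qq: "lorentz q q = r\<^sup>2" .
    have qp: "lorentz q p = 0" using vp by (simp add: q_def L.scaleR_left)
    have "lorentz (?c t) (?c t) = ((sinh (\<omega> * t))\<^sup>2 - (cosh (\<omega> * t))\<^sup>2) * r\<^sup>2"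
      by (simp add: L.add_left L.add_right L.scaleR_left L.scaleR_right pp qq qp sym[of p q]
          power2_eq_square algebra_simps)
    then show ?thesis by (simp add: cosh_square_eq)
  qed
  \<comment> \<open>The quadric equation holds for all \<open>t\<close>; the condition selecting the
    upper sheet is obtained near 0 by continuity, which is enough for a tangent vector.\<close>
  have "open {t. fst (?c t) > 0}"
    by (intro open_Collect_less continuous_intros)
  moreover have "0 \<in> {t. fst (?c t) > 0}" using p by (simp add: hyperbolic_space_def)
  ultimately obtain e where "e > 0" "ball 0 e \<subseteq> {t. fst (?c t) > 0}"
    using open_contains_ball by blast
  then have "?c t \<in> hyperbolic_space r" if "t \<in> {-e<..<e}" for t
    using that c by (auto simp: hyperbolic_space_def subset_iff dist_norm)
  then have "\<omega> *\<^sub>R q \<in> tangent_space (hyperbolic_space r) p"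
    using \<open>e > 0\<close>
    by (intro combination_tangent[where f = "\<lambda>t. cosh (\<omega> * t)" and h = "\<lambda>t. sinh (\<omega> * t)"
          and a = \<omega> and e = e]) (auto intro!: derivative_eq_intros)
  then show "v \<in> tangent_space (hyperbolic_space r) p" using \<open>\<omega> *\<^sub>R q = v\<close> by simp
qed (use \<open>r > 0\<close> in auto)

theorem proposition11:
  fixes r :: real
  assumes "r > 0"
  shows "\<not> (\<exists>S \<nu> V \<theta>. \<theta> \<notin> {0, pi} \<and>
              constant_parallel_angle (\<bullet>) (sphere (0 :: real^4) r) S \<nu> V \<theta>)
       \<and> \<not> (\<exists>S \<nu> V \<theta>. \<theta> \<notin> {0, pi} \<and>
              constant_parallel_angle lorentz (hyperbolic_space r) S \<nu> V \<theta>)"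
proof -
  \<comment> \<open>In both models the goal left to \<open>simp\<close> is that the ambient space,
    \<open>real^4\<close> or \<open>real \<times> (real^3)\<close>, has dimension 4.\<close>
  have "\<theta> \<in> {0, pi}" if "constant_parallel_angle (\<bullet>) (sphere (0 :: real^4) r) S \<nu> V \<theta>" for S \<nu> V \<theta>
    by (rule space_form.constant_parallel_angle_trivial[OF space_form_sphere[OF assms] _ that]) simp
  moreover have "\<theta> \<in> {0, pi}" if "constant_parallel_angle lorentz (hyperbolic_space r) S \<nu> V \<theta>" for S \<nu> V \<theta>
    by (rule space_form.constant_parallel_angle_trivial[OF space_form_hyperbolic[OF assms] _ that]) simp
  ultimately show ?thesis by metis
qed

end
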